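(* Let $n\ge1$ and let $K\subset(\mathbb{R}^{2n},\omega_0)$ be a convex polytope with $(2n-1)$-dimensional facets $\{F_i\}_{i=1}^N$. Let $n_i$ be the unit outer normal to $F_i$, and let $h_i=h_K(n_i)$ be the oriented height of $F_i$, where $h_K(y):=\sup_{x\in K}\langle x,y\rangle$ is the support function of $K$. Then $$c_{\rm EHZ}(K\times_L K)\leqslant 2\sum_{i=1}^{N}h_i^2,$$ where the capacity is taken in $\mathbb{R}^{2n}_q\times\mathbb{R}^{2n}_p=\mathbb{R}^{4n}$ with its standard symplectic form.
   Context: A convex polytope here is the convex hull of finitely many points with non-empty interior in $\mathbb{R}^{2n}$; $F_1,\dots,F_N$ are all of its facets. $\langle\cdot,\cdot\rangle$ is the Euclidean inner product. Symplectic form and complex structure: for $m\ge1$, $\mathbb{R}^{2m}=\mathbb{R}^m_q\times\mathbb{R}^m_p$ carries the standard symplectic form $\omega((q,p),(q',p'))=\langle q,p'\rangle-\langle p,q'\rangle$ and the standard complex structure $J_{2m}(q,p)=(-p,q)$, so that $\langle x,y\rangle_{\mathbb{R}^{2m}}=\omega(x,J_{2m}y)$. On $\mathbb{R}^{2n}$ this form is denoted $\omega_0$. Lagrangian product: for $A,B\subset\mathbb{R}^{2n}$, $A\times_L B=\{(q,p)\in\mathbb{R}^{2n}\times\mathbb{R}^{2n} : q\in A,\ p\in B\}\subset\mathbb{R}^{4n}$, where $\mathbb{R}^{4n}=\mathbb{R}^{2n}_q\times\mathbb{R}^{2n}_p$ has the standard symplectic form $\tilde\omega_0((q,p),(q',p'))=\langle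 q,p'\rangle_{\mathbb{R}^{2n}}-\langle p,q'\rangle_{\mathbb{R}^{2n}}$. Ekeland–Hofer–Zehnder capacity: for a convex body (compact convex set with non-empty interior) $C\subset(\mathbb{R}^{2m},\omega)$, $c_{\rm EHZ}(C)$ is the minimum of the action $A(\gamma)=\frac12\int_0^T\omega(\gamma(t),\dot\gamma(t))\,dt$ over all (generalized) closed characteristics on $\partial C$, i.e. non-constant absolutely continuous closed curves $\gamma:[0,T]\to\partial C$, $\gamma(0)=\gamma(T)$, with square-integrable derivative, such that $\dot\gamma(t)\in J_{2m}N_C(\gamma(t))$ for almost every $t$, where $N_C(x)=\{v:\langle v,y-x\rangle\le0\ \ \forall y\in C\}$ is the outer normal cone of $C$ at $x$. This coincides with the continuous extension (in the Hausdorff metric) to all convex bodies of the minimal action of closed characteristics on the boundary of smooth convex bodies. *)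

theory Defs
  imports "HOL-Analysis.Analysis"
begin

text \<open>For a Euclidean space \<open>'a\<close> of dimension \<open>m\<close>, the type \<open>'a \<times> 'a\<close> with its product inner
  product plays the role of \<open>\<real>\<^sup>2\<^sup>m = \<real>\<^sup>m\<^sub>q \<times> \<real>\<^sup>m\<^sub>p\<close>. Thus \<open>\<real>\<^sup>2\<^sup>n\<close> is \<open>real ^ 'n \<times> real ^ 'n\<close>, and \<open>\<real>\<^sup>4\<^sup>n\<close>
  is the product of two copies of it; the symplectic form of the latter pairs the first copy
  with the second.\<close>

definition symplectic_form :: "'a::euclidean_space \<times> 'a \<Rightarrow> 'a \<times> 'a \<Rightarrow> real" where
  "symplectic_form x y = fst x \<bullet> snd y - snd x \<bullet> fst y"

definition complex_structure :: "'a::euclidean_space \<times> 'a \<Rightarrow> 'a \<times> 'a" where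
  "complex_structure x = (- snd x, fst x)"

lemma inner_eq_symplectic_form: "x \<bullet> y = symplectic_form x (complex_structure y)"
  by (simp add: symplectic_form_def complex_structure_def inner_prod_def)

definition lagrangian_product :: "'a::euclidean_space set \<Rightarrow> 'a set \<Rightarrow> ('a \<times> 'a) set"
    (infixr \<open>\<times>\<^sub>L\<close> 80) where
  "A \<times>\<^sub>L B = {(q, p). q \<in> A \<and> p \<in> B}"

definition support_function :: "'a::euclidean_space set \<Rightarrow> 'a \<Rightarrow> real" where
  "support_function K y = (SUP x\<in>K. x \<bullet> y)"

definition outer_normal_cone :: "'a::euclidean_space set \<Rightarrow> 'a \<Rightarrow> 'a set" where
  "outer_normal_cone C x = {v. \<forall>y\<in>C. v \<bullet> (y - x) \<le> 0}"

definition unit_outer_normal :: "'a::euclidean_space set \<Rightarrow> 'a set \<Rightarrow> 'a \<Rightarrow> bool" where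
  "unit_outer_normal K F v \<longleftrightarrow> norm v = 1 \<and> (\<forall>x\<in>F. v \<in> outer_normal_cone K x)"

definition absolutely_continuous_on_interval ::
    "real \<Rightarrow> real \<Rightarrow> (real \<Rightarrow> 'a::real_normed_vector) \<Rightarrow> bool" where
  "absolutely_continuous_on_interval s t f \<longleftrightarrow>
     (\<forall>\<epsilon>>0. \<exists>\<delta>>0. \<forall>(m::nat) a b.
        (\<forall>i<m. s \<le> a i \<and> a i \<le> b i \<and> b i \<le> t) \<and>
        disjoint_family_on (\<lambda>i. {a i<..<b i}) {..<m} \<and>
        (\<Sum>i<m. b i - a i) < \<delta>
        \<longrightarrow> (\<Sum>i<m. norm (f (b i) - f (a i))) < \<epsilon>)"

abbreviation velocity :: "real \<Rightarrow> (real \<Rightarrow> 'a::real_normed_vector) \<Rightarrow> real \<Rightarrow> 'a" where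
  "velocity T \<gamma> t \<equiv> vector_derivative \<gamma> (at t within {0..T})"

text \<open>An absolutely continuous curve in a Euclidean space is differentiable almost everywhere;
  differentiability is nevertheless required explicitly below, since \<open>vector_derivative\<close> is
  arbitrary where the derivative does not exist.\<close>

definition closed_characteristic ::
    "('a::euclidean_space \<times> 'a) set \<Rightarrow> real \<Rightarrow> (real \<Rightarrow> 'a \<times> 'a) \<Rightarrow> bool" where
  "closed_characteristic C T \<gamma> \<longleftrightarrow>
     0 < T \<and>
     absolutely_continuous_on_interval 0 T \<gamma> \<and>
     \<gamma> ` {0..T} \<subseteq> frontier C \<and>
     \<gamma> 0 = \<gamma> T \<and>
     \<not> \<gamma> constant_on {0..T} \<and>
     integrable (lebesgue_on {0..T}) (\<lambda>t. (norm (velocity T \<gamma> t))\<^sup>2) \<and>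
     (AE t in lebesgue_on {0..T}.
        \<gamma> differentiable (at t within {0..T}) \<and>
        velocity T \<gamma> t \<in> complex_structure ` outer_normal_cone C (\<gamma> t))"

definition symplectic_action :: "real \<Rightarrow> (real \<Rightarrow> 'a::euclidean_space \<times> 'a) \<Rightarrow> real" where
  "symplectic_action T \<gamma> =
     1 / 2 * (LINT t|lebesgue_on {0..T}. symplectic_form (\<gamma> t) (velocity T \<gamma> t))"

text \<open>For a convex body the infimum is a minimum. It is taken in \<open>ereal\<close>, so that
  \<open>c_EHZ C \<le> ereal a\<close> cannot hold for lack of closed characteristics: their absence would give
  the value \<open>\<infinity>\<close>.\<close>

definition c_EHZ :: "('a::euclidean_space \<times> 'a) set \<Rightarrow> ereal" where
  "c_EHZ C = Inf {ereal (symplectic_action T \<gamma>) | T \<gamma>. closed_characteristic C T \<gamma>}"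

end

theory Submission
  imports Defs
begin

text \<open>The argument is Clarke duality in finite dimensions. Given vectors \<open>a\<^sub>k\<close>, \<open>b\<^sub>k\<close> with
  \<open>\<Sum> a\<^sub>k = \<Sum> b\<^sub>k = 0\<close>, normalised by \<open>\<Sum> h\<^sub>T(a\<^sub>k) \<le> 1\<close> and \<open>\<Sum> h\<^sub>K(b\<^sub>k) \<le> 1\<close>, the bilinear action
  \<open>- (\<Sum>l<k. a\<^sub>l \<bullet> b\<^sub>k)\<close> attains its maximum \<open>M\<close> on a compact set. The Lagrange multipliers of the two
  linear constraints translate the polygons with edges \<open>- a\<^sub>k / M\<close> and \<open>b\<^sub>k / M\<close> into \<open>K\<close> and \<open>T\<close> in such
  a way that, traversed alternately, they form a closed characteristic on the boundary of
  \<open>K \<times>\<^sub>L T\<close> of action \<open>1 / M\<close>.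

  For \<open>T = K\<close> take \<open>a\<^sub>k = b\<^sub>k = \<beta>\<^sub>k n\<^sub>k / s\<close> with \<open>\<beta>\<^sub>k \<ge> 0\<close>, \<open>\<Sum> \<beta>\<^sub>k n\<^sub>k = 0\<close> and \<open>s = \<Sum> \<beta>\<^sub>k h\<^sub>k\<close>. Since
  \<open>\<Sum> a\<^sub>k = 0\<close>, the action is half of \<open>\<Sum> \<bar>a\<^sub>k\<bar>\<^sup>2 = \<Sum> \<beta>\<^sub>k\<^sup>2 / s\<^sup>2\<close>, and Cauchy-Schwarz gives
  \<open>1 / M \<le> 2 s\<^sup>2 / \<Sum> \<beta>\<^sub>k\<^sup>2 \<le> 2 \<Sum> h\<^sub>k\<^sup>2\<close>.\<close>

section \<open>Polygonal closed characteristics\<close>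

lemma lipschitz_on_imp_absolutely_continuous:
  assumes "L-lipschitz_on {s..t} f"
  shows "absolutely_continuous_on_interval s t f"
  unfolding absolutely_continuous_on_interval_def
proof (intro allI impI)
  fix e :: real assume e: "e > 0"
  have L: "L \<ge> 0" using assms by (rule lipschitz_on_nonneg)
  show "\<exists>\<delta>>0. \<forall>(m::nat) a b.
        (\<forall>i<m. s \<le> a i \<and> a i \<le> b i \<and> b i \<le> t) \<and>
        disjoint_family_on (\<lambda>i. {a i<..<b i}) {..<m} \<and>
        (\<Sum>i<m. b i - a i) < \<delta>
        \<longrightarrow> (\<Sum>i<m. norm (f (b i) - f (a i))) < e"
  \<comment> \<open>Adding 1 keeps the denominator positive when \<open>L = 0\<close>.\<close>
  proof (intro exI[of _ "e / (L + 1)"] conjI allI impI)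
    show "0 < e / (L + 1)" using e L by simp
    fix m :: nat and a b
    assume H: "(\<forall>i<m. s \<le> a i \<and> a i \<le> b i \<and> b i \<le> t) \<and>
        disjoint_family_on (\<lambda>i. {a i<..<b i}) {..<m} \<and>
        (\<Sum>i<m. b i - a i) < e / (L + 1)"
    have "(\<Sum>i<m. norm (f (b i) - f (a i))) \<le> (\<Sum>i<m. (L + 1) * (b i - a i))"
    proof (rule sum_mono)
      fix i assume "i \<in> {..<m}"
      then have i: "s \<le> a i" "a i \<le> b i" "b i \<le> t" using H by auto
      have "norm (f (b i) - f (a i)) \<le> L * (b i - a i)"
        using lipschitz_onD[OF assms, of "b i" "a i"] i by (simp add: dist_norm)
      also have "\<dots> \<le> (L + 1) * (b i - a i)" using i by (simp add: algebra_simps)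
      finally show "norm (f (b i) - f (a i)) \<le> (L + 1) * (b i - a i)" .
    qed
    also have "\<dots> = (L + 1) * (\<Sum>i<m. b i - a i)" by (simp add: sum_distrib_left)
    also have "\<dots> < e" using H L by (simp add: field_simps)
    finally show "(\<Sum>i<m. norm (f (b i) - f (a i))) < e" .
  qed
qed

text \<open>Edge \<open>i\<close> is traversed during the time from \<open>i\<close> to
  \<open>i + 1\<close>. The clamped coefficients are ramps, each 1-Lipschitz in \<open>t\<close>, so
  the curve is globally Lipschitz without any gluing of pieces.\<close>

definition polygonal_curve :: "nat \<Rightarrow> (nat \<Rightarrow> 'a::real_normed_vector) \<Rightarrow> real \<Rightarrow> 'a" where
  "polygonal_curve n w t = w 0 + (\<Sum>i<n. max 0 (min 1 (t - real i)) *\<^sub>R (w (Suc i) - w i))"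

text \<open>On this interval the ramps before \<open>i\<close> have reached 1 and telescope to
  \<open>w i - w 0\<close>, while those after \<open>i\<close> are still 0.\<close>

lemma polygonal_curve_on_edge:
  assumes "i < n" "real i \<le> t" "t \<le> real i + 1"
  shows "polygonal_curve n w t = w i + (t - real i) *\<^sub>R (w (Suc i) - w i)"
proof -
  let ?f = "\<lambda>k. max 0 (min 1 (t - real k)) *\<^sub>R (w (Suc k) - w k)"
  have "(\<Sum>k<n. ?f k) = (\<Sum>k<i. ?f k) + (\<Sum>k=i..<n. ?f k)"
    using assms(1) sum.atLeastLessThan_concat[of 0 i n ?f] by (simp add: atLeast0LessThan)
  also have "(\<Sum>k=i..<n. ?f k) = ?f i + (\<Sum>k=Suc i..<n. ?f k)"
    using assms(1) by (rule sum.atLeast_Suc_lessThan)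
  finally have "(\<Sum>k<n. ?f k) = (\<Sum>k<i. ?f k) + (?f i + (\<Sum>k=Suc i..<n. ?f k))" .
  moreover have "(\<Sum>k=Suc i..<n. ?f k) = 0"
  proof (rule sum.neutral, intro ballI)
    fix k assume "k \<in> {Suc i..<n}"
    then have "real k \<ge> real i + 1" by auto
    then have "max 0 (min 1 (t - real k)) = 0" using assms(3) by linarith
    then show "?f k = 0" by simp
  qed
  moreover have "(\<Sum>k<i. ?f k) = (\<Sum>k<i. w (Suc k) - w k)"
  proof (rule sum.cong[OF refl])
    fix k assume "k \<in> {..<i}"
    then have "real k + 1 \<le> real i" by auto
    then have "max 0 (min 1 (t - real k)) = 1" using assms(2) by linarith
    then show "?f k = w (Suc k) - w k" by simp
  qed
  moreover have "(\<Sum>k<i. w (Suc k) - w k) = w i - w 0"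
    by (rule sum_lessThan_telescope)
  moreover have "max 0 (min 1 (t - real i)) = t - real i" using assms by linarith
  ultimately show ?thesis by (simp add: polygonal_curve_def)
qed

lemma polygonal_curve_vertex:
  assumes "i \<le> n" shows "polygonal_curve n w (real i) = w i"
proof (cases "i < n")
  case True then show ?thesis using polygonal_curve_on_edge[of i n "real i" w] by simp
next
  case False
  show ?thesis
  proof (cases n)
    case 0 then show ?thesis using assms by (simp add: polygonal_curve_def)
  next
    case (Suc k)
    then show ?thesis using polygonal_curve_on_edge[of k n "real n" w] False assms by simp
  qed
qed

lemma ex_edge:
  assumes "0 < n" "t \<in> {0..real n}"
  obtains i where "i < n" "real i \<le> t" "t \<le> real i + 1"
proof (cases "t = real n")
  case True
  then show ?thesis using that[of "n - 1"] assms by simp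
next
  case False
  have "nat \<lfloor>t\<rfloor> < n" using assms False by (simp add: nat_less_iff floor_less_iff)
  then show ?thesis using that[of "nat \<lfloor>t\<rfloor>"] assms by simp
qed

lemma polygonal_curve_has_vector_derivative:
  assumes "i < n" "real i < t" "t < real i + 1"
  shows "(polygonal_curve n w has_vector_derivative (w (Suc i) - w i)) (at t within S)"
proof -
  have "((\<lambda>t. w i + (t - real i) *\<^sub>R (w (Suc i) - w i)) has_vector_derivative (w (Suc i) - w i)) (at t)"
    by (auto intro!: derivative_eq_intros)
  then have "(polygonal_curve n w has_vector_derivative (w (Suc i) - w i)) (at t)"
    by (rule has_vector_derivative_transform_within_open[of _ _ _ "{real i<..<real i + 1}"])
       (use assms in \<open>auto simp: polygonal_curve_on_edge\<close>)
  then show ?thesis by (rule has_vector_derivative_at_within)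
qed

lemma velocity_polygonal_curve:
  assumes "i < n" "real i < t" "t < real i + 1"
  shows "velocity (real n) (polygonal_curve n w) t = w (Suc i) - w i"
  using vector_derivative_within_cbox[of 0 "real n" t "polygonal_curve n w"]
    polygonal_curve_has_vector_derivative[OF assms, of w "{0..real n}"] assms by simp

lemma polygonal_curve_lipschitz:
  "(\<Sum>i<n. norm (w (Suc i) - w i))-lipschitz_on S (polygonal_curve n w)"
proof (rule lipschitz_onI)
  fix s t
  have "dist (polygonal_curve n w s) (polygonal_curve n w t)
     = norm (\<Sum>i<n. (max 0 (min 1 (s - real i)) - max 0 (min 1 (t - real i))) *\<^sub>R (w (Suc i) - w i))"
    by (simp add: polygonal_curve_def dist_norm scaleR_left_diff_distrib sum_subtractf)
  also have "\<dots> \<le> (\<Sum>i<n. dist s t * norm (w (Suc i) - w i))"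
  proof (rule sum_norm_le)
    fix i
    have "\<bar>max 0 (min 1 (s - real i)) - max 0 (min 1 (t - real i))\<bar> \<le> dist s t"
      by (auto simp: dist_real_def max_def min_def)
    then show "norm ((max 0 (min 1 (s - real i)) - max 0 (min 1 (t - real i))) *\<^sub>R (w (Suc i) - w i))
       \<le> dist s t * norm (w (Suc i) - w i)" by (simp add: mult_right_mono)
  qed
  also have "\<dots> = (\<Sum>i<n. norm (w (Suc i) - w i)) * dist s t"
    by (simp add: sum_distrib_left mult.commute)
  finally show "dist (polygonal_curve n w s) (polygonal_curve n w t) \<le> (\<Sum>i<n. norm (w (Suc i) - w i)) * dist s t" .
qed (simp add: sum_nonneg)

text \<open>Off the finitely many integer times \<open>f\<close> is a step function on intervals of
  length 1. Nothing is assumed at these times, where a polygonal curve may have no velocity.\<close>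

lemma has_bochner_integral_unit_steps:
  fixes f :: "real \<Rightarrow> real"
  assumes "\<And>i t. i < n \<Longrightarrow> real i < t \<Longrightarrow> t < real i + 1 \<Longrightarrow> f t = c i"
  shows "has_bochner_integral (lebesgue_on {0..real n}) f (\<Sum>i<n. c i)"
proof -
  let ?M = "lebesgue_on {0..real n}"
  let ?g = "\<lambda>t. \<Sum>i<n. c i * indicator {real i<..<real i + 1} t"
  have "has_bochner_integral ?M ?g (\<Sum>i<n. c i * 1)"
  proof (intro has_bochner_integral_sum has_bochner_integral_mult_right)
    fix i assume "i \<in> {..<n}"
    then have sub: "{real i<..<real i + 1} \<subseteq> {0..real n}" by auto
    then have [measurable]: "{real i<..<real i + 1} \<in> sets ?M"
      by (simp add: sets_restrict_space_iff)
    have "emeasure ?M {real i<..<real i + 1} = 1"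
      using sub by (simp add: emeasure_restrict_space)
    then have "has_bochner_integral ?M (indicator {real i<..<real i + 1}) (measure ?M {real i<..<real i + 1})"
      by (intro has_bochner_integral_real_indicator) auto
    moreover have "measure ?M {real i<..<real i + 1} = 1"
      using \<open>emeasure ?M {real i<..<real i + 1} = 1\<close> by (simp add: measure_def)
    ultimately show "has_bochner_integral ?M (\<lambda>t. indicator {real i<..<real i + 1} t) (1::real)" by simp
  qed
  moreover have "has_bochner_integral ?M ?g x = has_bochner_integral ?M f x" for x
  proof (rule has_bochner_integral_discrete_difference[where X="real ` {..n}"])
    fix t assume "t \<in> real ` {..n}"
    then have t: "{t} \<subseteq> {0..real n}" by auto
    then show "{t} \<in> sets ?M" by (simp add: sets_restrict_space_iff)
    show "emeasure ?M {t} = 0" using t by (simp add: emeasure_restrict_space)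
  next
    fix t assume t: "t \<in> space ?M" "t \<notin> real ` {..n}"
    then have "0 < n" "t \<in> {0..real n}" by auto
    then obtain i where i: "i < n" "real i \<le> t" "t \<le> real i + 1" by (rule ex_edge)
    have "real i \<in> real ` {..n}" "real (Suc i) \<in> real ` {..n}" using i(1) by (intro imageI; simp)+
    then have "t \<noteq> real i" "t \<noteq> real (Suc i)" using t(2) by metis+
    with i have i': "real i < t" "t < real i + 1" by auto
    have "?g t = (\<Sum>k<n. if k = i then c i else 0)"
    proof (rule sum.cong[OF refl])
      fix k
      have "k = i" if "real k < t" "t < real k + 1" using that i' by linarith
      then show "c k * indicator {real k<..<real k + 1} t = (if k = i then c i else 0)"
        using i' by (auto simp: indicator_def)
    qed
    then show "?g t = f t" using assms[OF i(1) i'] i(1) by simp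
  qed auto
  ultimately show ?thesis by simp
qed

section \<open>Normal cones and characteristic polygons\<close>

lemma complex_structure_0 [simp]: "complex_structure 0 = 0"
  by (simp add: complex_structure_def zero_prod_def)

lemma inner_complex_structure_self: "x \<bullet> complex_structure x = 0"
  by (simp add: complex_structure_def inner_prod_def inner_commute)

text \<open>The form vanishes on \<open>(y, y)\<close>; hence the action integrand is constant along
  an edge.\<close>

lemma symplectic_form_add_scale: "symplectic_form (x + s *\<^sub>R y) y = symplectic_form x y"
  by (simp add: symplectic_form_def inner_add_left inner_add_right inner_commute[of "snd y" "fst y"])

text \<open>A normal vector \<open>v\<close> at \<open>x\<close> stays normal along the ray in direction \<open>J v\<close>, because \<open>J v\<close> is
  orthogonal to \<open>v\<close>.\<close>

lemma characteristic_direction_along: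
  assumes "d \<in> complex_structure ` outer_normal_cone C x"
  shows "d \<in> complex_structure ` outer_normal_cone C (x + s *\<^sub>R d)"
proof -
  obtain v where v: "v \<in> outer_normal_cone C x" "d = complex_structure v" using assms by auto
  then have "v \<in> outer_normal_cone C (x + s *\<^sub>R d)"
    by (auto simp: outer_normal_cone_def inner_diff_right inner_add_right inner_complex_structure_self)
  then show ?thesis using v by auto
qed

lemma outer_normal_cone_interior:
  assumes "x \<in> interior C" "v \<in> outer_normal_cone C x"
  shows "v = 0"
proof (rule ccontr)
  assume "v \<noteq> 0"
  obtain e where e: "e > 0" "cball x e \<subseteq> C" using assms(1) by (auto simp: mem_interior_cball)
  have "x + (e / norm v) *\<^sub>R v \<in> C" using e \<open>v \<noteq> 0\<close> by (intro subsetD[OF e(2)]) (simp add: dist_norm)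
  then have "v \<bullet> ((e / norm v) *\<^sub>R v) \<le> 0"
    using assms(2) by (fastforce simp: outer_normal_cone_def)
  then have "(e / norm v) * (v \<bullet> v) \<le> 0" by simp
  moreover have "(e / norm v) * (v \<bullet> v) > 0" using e \<open>v \<noteq> 0\<close> by simp
  ultimately show False by linarith
qed

text \<open>At an interior point the normal cone is trivial, so a polygon with an interior vertex
  stands still from there on. Being closed, it would then be constant, against the nondegenerate
  edge \<open>k\<close>.\<close>

lemma characteristic_polygon_in_frontier:
  assumes C: "\<And>i. i \<le> n \<Longrightarrow> w i \<in> C"
    and closed: "w n = w 0"
    and edge: "\<And>i. i < n \<Longrightarrow> w (Suc i) - w i \<in> complex_structure ` outer_normal_cone C (w i)"
    and k: "k < n" "w (Suc k) \<noteq> w k"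
    and i: "i \<le> n"
  shows "w i \<in> frontier C"
proof (rule ccontr)
  assume "w i \<notin> frontier C"
  then have int: "w i \<in> interior C" using C[OF i] closure_subset by (auto simp: frontier_def)
  have stay: "w j' = w j" if "j \<le> j'" "j' \<le> n" "w j \<in> interior C" for j j'
    using that
  proof (induction rule: dec_induct)
    case (step l)
    then have l: "w l = w j" "w l \<in> interior C" "l < n" by auto
    obtain v where v: "v \<in> outer_normal_cone C (w l)" "w (Suc l) - w l = complex_structure v"
      using edge[OF l(3)] by auto
    have "w (Suc l) - w l = 0" using v outer_normal_cone_interior[OF l(2) v(1)]
      by simp
    then show ?case using l by simp
  qed simp
  have "w 0 = w i" using stay[OF i le_refl int] closed by simp
  then have "w j = w i" if "j \<le> n" for j using stay[of 0 j] that int by simp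
  then show False using k by simp
qed

text \<open>Each edge is checked only at its starting vertex, since its direction stays
  characteristic along it. Edges of length zero are allowed; edge \<open>k\<close> prevents the
  curve from being constant.\<close>

lemma closed_characteristic_polygonal_curve:
  fixes w :: "nat \<Rightarrow> 'a::euclidean_space \<times> 'a"
  assumes conv: "convex C"
    and C: "\<And>i. i \<le> n \<Longrightarrow> w i \<in> C"
    and closed: "w n = w 0"
    and edge: "\<And>i. i < n \<Longrightarrow> w (Suc i) - w i \<in> complex_structure ` outer_normal_cone C (w i)"
    and k: "k < n" "w (Suc k) \<noteq> w k"
  shows "closed_characteristic C (real n) (polygonal_curve n w)"
  unfolding closed_characteristic_def
proof (intro conjI)
  let ?g = "polygonal_curve n w"
  show n: "0 < real n" using k by simp
  show "absolutely_continuous_on_interval 0 (real n) ?g"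
    by (rule lipschitz_on_imp_absolutely_continuous, rule polygonal_curve_lipschitz)
  show "?g ` {0..real n} \<subseteq> frontier C"
  proof
    fix y assume "y \<in> ?g ` {0..real n}"
    then obtain t where t: "t \<in> {0..real n}" "y = ?g t" by auto
    obtain i where i: "i < n" "real i \<le> t" "t \<le> real i + 1" using ex_edge n t(1) by auto
    define s where "s = t - real i"
    have s: "0 \<le> s" "s \<le> 1" using i by (auto simp: s_def)
    have y: "y = w i + s *\<^sub>R (w (Suc i) - w i)"
      using polygonal_curve_on_edge[OF i] t(2) s_def by simp
    show "y \<in> frontier C"
    \<comment> \<open>A stationary edge reduces to the vertex case; a nonzero edge comes from a
      nonzero normal, which excludes interior points.\<close>
    proof (cases "w (Suc i) = w i")
      case True
      then show ?thesis
        using characteristic_polygon_in_frontier[of n w C k i, OF C closed edge k] i y by simp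
    next
      case False
      have "y = (1 - s) *\<^sub>R w i + s *\<^sub>R w (Suc i)" using y by (simp add: algebra_simps)
      also have "\<dots> \<in> C" using conv C[of i] C[of "Suc i"] i s by (auto simp: convex_alt)
      finally have yC: "y \<in> C" .
      obtain v where v: "v \<in> outer_normal_cone C y" "w (Suc i) - w i = complex_structure v"
        using characteristic_direction_along[OF edge[OF i(1)], of s] y by auto
      have "y \<notin> interior C"
      proof
        assume "y \<in> interior C"
        then have "v = 0" using v(1) by (rule outer_normal_cone_interior)
        then show False using v(2) False by simp
      qed
      then show ?thesis using yC closure_subset by (auto simp: frontier_def)
    qed
  qed
  show "?g 0 = ?g (real n)"
    using polygonal_curve_vertex[of 0 n w] polygonal_curve_vertex[of n n w] closed by simp
  show "\<not> ?g constant_on {0..real n}"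
  proof
    assume "?g constant_on {0..real n}"
    then obtain c where c: "\<And>t. t \<in> {0..real n} \<Longrightarrow> ?g t = c" by (auto simp: constant_on_def)
    then have "?g (real k) = ?g (real (Suc k))" using k by simp
    then show False using k polygonal_curve_vertex[of k n w] polygonal_curve_vertex[of "Suc k" n w] by simp
  qed
  show "integrable (lebesgue_on {0..real n}) (\<lambda>t. (norm (velocity (real n) ?g t))\<^sup>2)"
    by (rule integrable.intros,
        rule has_bochner_integral_unit_steps[where c="\<lambda>i. (norm (w (Suc i) - w i))\<^sup>2"])
       (simp add: velocity_polygonal_curve)
  have "AE t in lebesgue_on {0..real n}. t \<notin> real ` {..n}"
  proof (rule AE_I')
    show "real ` {..n} \<in> null_sets (lebesgue_on {0..real n})"
      by (subst null_sets_restrict_space) (auto intro!: null_sets_completionI finite_imp_null_set_lborel)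
  qed auto
  then show "AE t in lebesgue_on {0..real n}. ?g differentiable (at t within {0..real n}) \<and>
        velocity (real n) ?g t \<in> complex_structure ` outer_normal_cone C (?g t)"
  proof (rule AE_mp, intro AE_I2 impI)
    fix t assume t: "t \<in> space (lebesgue_on {0..real n})" "t \<notin> real ` {..n}"
    then have "t \<in> {0..real n}" by simp
    then obtain i where i: "i < n" "real i \<le> t" "t \<le> real i + 1" using ex_edge n by auto
    have "real i \<in> real ` {..n}" "real (Suc i) \<in> real ` {..n}" using i(1) by (intro imageI; simp)+
    then have "t \<noteq> real i" "t \<noteq> real (Suc i)" using t(2) by metis+
    with i have i': "real i < t" "t < real i + 1" by auto
    show "?g differentiable (at t within {0..real n}) \<and>
        velocity (real n) ?g t \<in> complex_structure ` outer_normal_cone C (?g t)"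
      using polygonal_curve_has_vector_derivative[OF i(1) i', of w "{0..real n}"]
        velocity_polygonal_curve[OF i(1) i', of w] polygonal_curve_on_edge[OF i, of w]
        characteristic_direction_along[OF edge[OF i(1)], of "t - real i"]
      by (auto simp: differentiableI_vector)
  qed
qed

lemma symplectic_action_polygonal_curve:
  "symplectic_action (real n) (polygonal_curve n w) =
     (\<Sum>i<n. symplectic_form (w i) (w (Suc i) - w i)) / 2"
proof -
  have "has_bochner_integral (lebesgue_on {0..real n})
     (\<lambda>t. symplectic_form (polygonal_curve n w t) (velocity (real n) (polygonal_curve n w) t))
     (\<Sum>i<n. symplectic_form (w i) (w (Suc i) - w i))"
    by (rule has_bochner_integral_unit_steps)
       (simp add: velocity_polygonal_curve polygonal_curve_on_edge symplectic_form_add_scale)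
  then show ?thesis
    by (simp add: symplectic_action_def has_bochner_integral_integral_eq)
qed

section \<open>Multipliers of a maximal bilinear action\<close>

text \<open>For nonempty \<open>P\<close> this is the polar of \<open>P + U\<close>. With
  \<open>P\<close> a power of a convex body and \<open>U\<close> the diagonal, it consists of the
  vectors whose components sum to 0 and whose support function values sum to at most 1.\<close>

definition relative_polar :: "'e::euclidean_space set \<Rightarrow> 'e set \<Rightarrow> 'e set" where
  "relative_polar U P = {b. (\<forall>u\<in>U. u \<bullet> b = 0) \<and> (\<forall>x\<in>P. x \<bullet> b \<le> 1)}"

text \<open>The point of the ball farthest in direction \<open>b\<close> has inner product
  \<open>r * norm b\<close> with \<open>b\<close>, because the centre is orthogonal to
  \<open>b\<close>. With \<open>c = 1\<close> this bounds the relative polar.\<close>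

lemma inner_bound_on_ball:
  assumes "u \<in> U" "cball u r \<subseteq> P" "0 < r" "\<And>u. u \<in> U \<Longrightarrow> u \<bullet> b = 0" "\<And>x. x \<in> P \<Longrightarrow> x \<bullet> b \<le> c"
  shows "r * norm b \<le> c"
proof (cases "b = 0")
  case True
  have "u \<in> P" using assms(2,3) by auto
  then show ?thesis using assms(5)[of u] True by simp
next
  case False
  have "u + (r / norm b) *\<^sub>R b \<in> P"
    using assms(3) False by (intro subsetD[OF assms(2)]) (simp add: dist_norm)
  then have "(u + (r / norm b) *\<^sub>R b) \<bullet> b \<le> c" by (rule assms(5))
  then show ?thesis using assms(1,4) False
    by (simp add: inner_add_left dot_square_norm power2_eq_square)
qed

lemma compact_relative_polar:
  assumes "u \<in> U" "cball u r \<subseteq> P" "0 < r"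
  shows "compact (relative_polar U P)"
  unfolding compact_eq_bounded_closed
proof
  show "bounded (relative_polar U P)"
    unfolding bounded_iff
  proof (intro exI[of _ "1 / r"] ballI)
    fix b assume "b \<in> relative_polar U P"
    then have "r * norm b \<le> 1"
      using assms by (intro inner_bound_on_ball[of u U r P b 1]) (auto simp: relative_polar_def)
    then show "norm b \<le> 1 / r" using assms(3) by (simp add: field_simps)
  qed
  have "relative_polar U P = (\<Inter>u\<in>U. {b. u \<bullet> b = 0}) \<inter> (\<Inter>x\<in>P. {b. x \<bullet> b \<le> 1})"
    by (auto simp: relative_polar_def)
  then show "closed (relative_polar U P)"
    by (auto intro!: closed_INT closed_Int closed_hyperplane closed_halfspace_le)
qed

text \<open>This is the bipolar theorem for \<open>P + U\<close>, which is closed as the sum of a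
  compact and a closed set: a hyperplane separating \<open>y\<close> from it would yield an element
  of the polar violating the bound on \<open>y\<close>.\<close>

lemma relative_bipolar:
  assumes "subspace U" "compact P" "convex P" "u \<in> U" "cball u r \<subseteq> P" "0 < r"
    and y: "\<And>b. b \<in> relative_polar U P \<Longrightarrow> y \<bullet> b \<le> 1"
  obtains v where "v \<in> U" "y - v \<in> P"
proof -
  let ?D = "\<Union>x\<in>P. \<Union>v\<in>U. {x + v}"
  have "y \<in> ?D"
  proof (rule ccontr)
    assume "y \<notin> ?D"
    moreover have "closed ?D"
      using assms by (intro compact_closed_sums closed_subspace)
    moreover have "convex ?D"
      using assms(3) subspace_imp_convex[OF assms(1)] by (rule convex_sums)
    ultimately obtain a c where "a \<bullet> y < c" "\<forall>z\<in>?D. c < a \<bullet> z"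
      using separating_hyperplane_closed_point[of ?D y] by blast
    define b where "b = - a"
    have gt: "y \<bullet> b > - c" using \<open>a \<bullet> y < c\<close> by (simp add: b_def inner_commute)
    have bD: "(x + v) \<bullet> b < - c" if "x \<in> P" "v \<in> U" for x v
    proof -
      have "c < a \<bullet> (x + v)" using that \<open>\<forall>z\<in>?D. c < a \<bullet> z\<close> by blast
      then show ?thesis by (simp add: b_def inner_commute)
    qed
    have "u \<in> P" using assms(5,6) by auto
    have orth: "v \<bullet> b = 0" if "v \<in> U" for v
    proof (rule ccontr)
      assume nz: "v \<bullet> b \<noteq> 0"
      \<comment> \<open>This \<open>k\<close> makes \<open>(u + k *\<^sub>R v) \<bullet> b\<close>
        equal to \<open>- c\<close>, contradicting the strict bound.\<close>
      define k where "k = (- c - u \<bullet> b) / (v \<bullet> b)"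
      have "k *\<^sub>R v \<in> U" using assms(1) that by (simp add: subspace_scale)
      then show False using bD[OF \<open>u \<in> P\<close>, of "k *\<^sub>R v"] nz by (simp add: inner_add_left k_def)
    qed
    have Pb: "x \<bullet> b < - c" if "x \<in> P" for x
      using bD[OF that, of 0] assms(1) by (simp add: subspace_0)
    then have "r * norm b \<le> - c"
      using assms orth by (intro inner_bound_on_ball[of u U r P b]) (auto intro: less_imp_le)
    moreover have "0 < - c" using Pb[OF \<open>u \<in> P\<close>] orth[OF assms(4)] by simp
    ultimately have "(1 / - c) *\<^sub>R b \<in> relative_polar U P"
      using Pb orth by (auto simp: relative_polar_def field_simps intro: less_imp_le)
    then have "y \<bullet> ((1 / - c) *\<^sub>R b) \<le> 1" by (rule y)
    then show False using gt \<open>0 < - c\<close> by (simp add: field_simps)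
  qed
  then show ?thesis using that by (auto simp: algebra_simps)
qed

text \<open>Clarke duality in finite dimensions: a maximiser \<open>(a, b)\<close> of the bilinear action satisfies
  the Lagrange multiplier conditions, and these place \<open>L a\<close> and \<open>L' b\<close>, rescaled and translated, in
  \<open>P\<close> and \<open>P'\<close> with \<open>b\<close> and \<open>a\<close> as outer normals.\<close>

lemma bilinear_maximum_multipliers:
  fixes P P' U :: "'e::euclidean_space set" and L L' :: "'e \<Rightarrow> 'e"
  assumes U: "subspace U"
    and P: "compact P" "convex P" "u \<in> U" "cball u r \<subseteq> P" "0 < r"
    and P': "compact P'" "convex P'" "u' \<in> U" "cball u' r' \<subseteq> P'" "0 < r'"
    and L: "continuous_on UNIV L"
    and adj: "\<And>a b. a \<in> relative_polar U P' \<Longrightarrow> b \<in> relative_polar U P \<Longrightarrow> L a \<bullet> b = a \<bullet> L' b"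
    and a0: "a0 \<in> relative_polar U P'" and b0: "b0 \<in> relative_polar U P" and pos: "0 < L a0 \<bullet> b0"
  obtains M a b v v' where "L a0 \<bullet> b0 \<le> M" "a \<in> relative_polar U P'" "b \<in> relative_polar U P"
    "v \<in> U" "v' \<in> U" "(1 / M) *\<^sub>R L a - v \<in> P" "(1 / M) *\<^sub>R L' b - v' \<in> P'"
    "((1 / M) *\<^sub>R L a - v) \<bullet> b = 1" "((1 / M) *\<^sub>R L' b - v') \<bullet> a = 1"
proof -
  let ?S = "relative_polar U P' \<times> relative_polar U P"
  have "compact ?S"
    using compact_relative_polar[OF P(3-5)] compact_relative_polar[OF P'(3-5)] by (rule compact_Times[rotated])
  moreover have "?S \<noteq> {}" using a0 b0 by auto
  moreover have "continuous_on ?S (\<lambda>z. L (fst z) \<bullet> snd z)"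
    by (intro continuous_intros continuous_on_compose2[OF L]) auto
  ultimately obtain z where z: "z \<in> ?S" "\<And>y. y \<in> ?S \<Longrightarrow> L (fst y) \<bullet> snd y \<le> L (fst z) \<bullet> snd z"
    using continuous_attains_sup[of ?S] by blast
  define a b M where "a = fst z" and "b = snd z" and "M = L a \<bullet> b"
  have ab: "a \<in> relative_polar U P'" "b \<in> relative_polar U P" using z(1) by (auto simp: a_def b_def)
  have max: "L a1 \<bullet> b1 \<le> M" if "a1 \<in> relative_polar U P'" "b1 \<in> relative_polar U P" for a1 b1
    using z(2)[of "(a1, b1)"] that by (simp add: a_def b_def M_def)
  have M0: "L a0 \<bullet> b0 \<le> M" using max a0 b0 by blast
  have M: "0 < M" using M0 pos by simp
  \<comment> \<open>With \<open>a\<close> fixed, maximality puts \<open>L a / M\<close> into the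
    bipolar, that is, into \<open>P + U\<close>. The translation \<open>v\<close> is the multiplier
    of the constraint that \<open>b\<close> is orthogonal to \<open>U\<close>.\<close>
  have "((1 / M) *\<^sub>R L a) \<bullet> b1 \<le> 1" if "b1 \<in> relative_polar U P" for b1
    using max[OF ab(1) that] M by simp
  then obtain v where v: "v \<in> U" "(1 / M) *\<^sub>R L a - v \<in> P"
    using relative_bipolar[OF U P, of "(1 / M) *\<^sub>R L a"] by blast
  have "((1 / M) *\<^sub>R L' b) \<bullet> a1 \<le> 1" if "a1 \<in> relative_polar U P'" for a1
    using max[OF that ab(2)] M adj[OF that ab(2)] by (simp add: inner_commute)
  then obtain v' where v': "v' \<in> U" "(1 / M) *\<^sub>R L' b - v' \<in> P'"
    using relative_bipolar[OF U P', of "(1 / M) *\<^sub>R L' b"] by blast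
  have "((1 / M) *\<^sub>R L a - v) \<bullet> b = 1"
    using v(1) ab(2) M by (simp add: inner_diff_left relative_polar_def M_def[symmetric])
  moreover have "((1 / M) *\<^sub>R L' b - v') \<bullet> a = 1"
  proof -
    have "L' b \<bullet> a = M" using adj[OF ab] by (simp add: M_def inner_commute)
    then show ?thesis using v'(1) ab(1) M by (simp add: inner_diff_left relative_polar_def)
  qed
  ultimately show ?thesis using that[OF M0 ab v(1) v'(1) v(2) v'(2)] by blast
qed

section \<open>Closed characteristics of Lagrangian products\<close>

lemma outer_normal_cone_lagrangian_product:
  assumes "u \<in> outer_normal_cone K q" "v \<in> outer_normal_cone T p"
  shows "(u, v) \<in> outer_normal_cone (K \<times>\<^sub>L T) (q, p)"
  using assms by (fastforce simp: outer_normal_cone_def lagrangian_product_def intro: add_nonpos_nonpos)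

lemma sum_lessThan_double:
  fixes f :: "nat \<Rightarrow> 'b::comm_monoid_add"
  shows "(\<Sum>i<2 * m. f i) = (\<Sum>j<m. f (2 * j) + f (Suc (2 * j)))"
  by (induction m) (simp_all add: add.assoc)

text \<open>The curve alternately moves \<open>p\<close> along a normal of \<open>K\<close> at fixed \<open>q\<close> and \<open>q\<close> against a normal
  of \<open>T\<close> at fixed \<open>p\<close>.\<close>

lemma c_EHZ_lagrangian_product_le_polygon:
  fixes q p :: "nat \<Rightarrow> 'a::euclidean_space"
  assumes conv: "convex K" "convex T"
    and closed: "q m = q 0" "p m = p 0"
    and mem: "\<And>j. j \<le> m \<Longrightarrow> q j \<in> K" "\<And>j. j \<le> m \<Longrightarrow> p j \<in> T"
    and normal: "\<And>j. j < m \<Longrightarrow> p (Suc j) - p j \<in> outer_normal_cone K (q j)"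
      "\<And>j. j < m \<Longrightarrow> q j - q (Suc j) \<in> outer_normal_cone T (p (Suc j))"
    and nz: "(\<Sum>j<m. q j \<bullet> (p (Suc j) - p j)) \<noteq> 0"
  shows "c_EHZ (K \<times>\<^sub>L T) \<le> ereal (\<Sum>j<m. q j \<bullet> (p (Suc j) - p j))"
proof -
  \<comment> \<open>Even vertices are \<open>(q j, p j)\<close> and odd ones
    \<open>(q j, p (Suc j))\<close>: \<open>p\<close> moves first, then \<open>q\<close>.\<close>
  define w where "w i = (q (i div 2), p (Suc i div 2))" for i
  let ?g = "polygonal_curve (2 * m) w"
  have even: "w (Suc (2 * j)) - w (2 * j) = complex_structure (p (Suc j) - p j, 0)" for j
    by (simp add: w_def complex_structure_def)
  have odd: "w (Suc (Suc (2 * j))) - w (Suc (2 * j)) = complex_structure (0, q j - q (Suc j))" for j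
    by (simp add: w_def complex_structure_def)
  have zero: "0 \<in> outer_normal_cone A x" for A :: "'a set" and x
    by (simp add: outer_normal_cone_def)
  have edge: "w (Suc i) - w i \<in> complex_structure ` outer_normal_cone (K \<times>\<^sub>L T) (w i)" if "i < 2 * m" for i
  proof (cases "even i")
    case True
    then obtain j where j: "i = 2 * j" by auto
    then have "(p (Suc j) - p j, 0) \<in> outer_normal_cone (K \<times>\<^sub>L T) (w i)"
      using normal(1)[of j] zero that by (auto simp: w_def intro: outer_normal_cone_lagrangian_product)
    then show ?thesis using even j by simp
  next
    case False
    then obtain j where j: "i = Suc (2 * j)" by (auto elim: oddE)
    then have "(0, q j - q (Suc j)) \<in> outer_normal_cone (K \<times>\<^sub>L T) (w i)"
      using normal(2)[of j] zero that by (auto simp: w_def intro: outer_normal_cone_lagrangian_product)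
    then show ?thesis using odd j by simp
  qed
  have mem_w: "w i \<in> K \<times>\<^sub>L T" if "i \<le> 2 * m" for i
    using mem that by (auto simp: w_def lagrangian_product_def)
  have "K \<times>\<^sub>L T = K \<times> T" by (auto simp: lagrangian_product_def)
  then have conv_w: "convex (K \<times>\<^sub>L T)" using conv by (simp add: convex_Times)
  obtain j where j: "j < m" "p (Suc j) - p j \<noteq> 0"
  proof (rule ccontr)
    assume "\<not> thesis"
    then have "\<forall>j\<in>{..<m}. q j \<bullet> (p (Suc j) - p j) = 0" using that by fastforce
    then show False using nz by (simp add: sum.neutral)
  qed
  have char: "closed_characteristic (K \<times>\<^sub>L T) (real (2 * m)) ?g"
  proof (rule closed_characteristic_polygonal_curve[where k="2 * j"])
    show "w (2 * m) = w 0" "2 * j < 2 * m" "w (Suc (2 * j)) \<noteq> w (2 * j)"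
      using closed j by (simp_all add: w_def)
  qed (use conv_w mem_w edge in auto)
  have "(\<Sum>i<2 * m. symplectic_form (w i) (w (Suc i) - w i))
      = (\<Sum>j<m. q j \<bullet> (p (Suc j) - p j) - p (Suc j) \<bullet> (q (Suc j) - q j))"
    by (simp add: sum_lessThan_double w_def symplectic_form_def)
  \<comment> \<open>Summation by parts: both families of edges contribute equally up to a
    telescoping term, which vanishes because the polygon closes up. The factor 2 cancels the 1/2 of
    the action.\<close>
  also have "\<dots> = (\<Sum>j<m. 2 * (q j \<bullet> (p (Suc j) - p j)) - (q (Suc j) \<bullet> p (Suc j) - q j \<bullet> p j))"
    by (rule sum.cong) (simp_all add: algebra_simps inner_commute)
  also have "\<dots> = 2 * (\<Sum>j<m. q j \<bullet> (p (Suc j) - p j)) - (q m \<bullet> p m - q 0 \<bullet> p 0)"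
    by (subst sum_subtractf, subst sum_lessThan_telescope) (simp add: sum_distrib_left)
  finally have "symplectic_action (real (2 * m)) ?g = (\<Sum>j<m. q j \<bullet> (p (Suc j) - p j))"
    using closed by (simp only: symplectic_action_polygonal_curve) simp
  then show ?thesis
    using char unfolding c_EHZ_def by (metis (mono_tags, lifting) Inf_lower mem_Collect_eq)
qed

section \<open>Powers of a convex body and the diagonal\<close>

definition cartesian_power :: "'a set \<Rightarrow> ('a ^ 'k) set" where
  "cartesian_power K = {x. \<forall>k. x $ k \<in> K}"

lemma convex_cartesian_power: "convex K \<Longrightarrow> convex (cartesian_power K)"
  by (auto simp: cartesian_power_def convex_def)

lemma compact_cartesian_power:
  fixes K :: "'a::euclidean_space set"
  assumes "compact K"
  shows "compact (cartesian_power K :: ('a ^ 'k::finite) set)"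
  unfolding compact_eq_bounded_closed
proof
  obtain B where B: "\<And>x. x \<in> K \<Longrightarrow> norm x \<le> B"
    using assms compact_imp_bounded bounded_iff by metis
  have "norm x \<le> real CARD('k) * B" if "x \<in> cartesian_power K" for x :: "'a ^ 'k"
  proof -
    have "norm x \<le> (\<Sum>k\<in>UNIV. norm (x $ k))"
      unfolding norm_vec_def by (rule L2_set_le_sum) simp
    also have "\<dots> \<le> (\<Sum>k\<in>(UNIV::'k set). B)"
      using that B by (intro sum_mono) (auto simp: cartesian_power_def)
    finally show ?thesis by simp
  qed
  then show "bounded (cartesian_power K :: ('a ^ 'k) set)" by (auto simp: bounded_iff)
  have "cartesian_power K = (\<Inter>k. (\<lambda>x::'a ^ 'k. x $ k) -` K)" by (auto simp: cartesian_power_def)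
  moreover have "closed ((\<lambda>x::'a ^ 'k. x $ k) -` K)" for k
    using assms by (intro closed_vimage compact_imp_closed continuous_intros)
  ultimately show "closed (cartesian_power K :: ('a ^ 'k) set)"
    by (metis (no_types, lifting) closed_INT)
qed

text \<open>This supplies the ball with centre in the diagonal that the duality lemmas
  require.\<close>

lemma cball_subset_cartesian_power:
  fixes x :: "'a::euclidean_space"
  assumes "cball x r \<subseteq> K"
  shows "cball (vec x) r \<subseteq> (cartesian_power K :: ('a ^ 'k::finite) set)"
proof
  fix y :: "'a ^ 'k" assume y: "y \<in> cball (vec x) r"
  have "y $ k \<in> K" for k
  proof -
    have "norm (x - y $ k) \<le> norm (vec x - y)"
      using Finite_Cartesian_Product.norm_nth_le[of "vec x - y" k] by simp
    then show ?thesis using y assms by (auto simp: dist_norm)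
  qed
  then show "y \<in> cartesian_power K" by (simp add: cartesian_power_def)
qed

text \<open>The diagonal represents translations of all vertices of a polygon by one common
  vector.\<close>

lemma subspace_range_vec: "subspace (range (vec :: 'a::real_vector \<Rightarrow> 'a ^ 'k))"
proof (rule subspaceI)
  show "0 \<in> range (vec :: 'a \<Rightarrow> 'a ^ 'k)" by (rule image_eqI[of _ _ 0]) (simp_all add: vec_eq_iff)
next
  fix x y :: "'a ^ 'k" assume "x \<in> range vec" "y \<in> range vec"
  then obtain c d where "x = vec c" "y = vec d" by auto
  then show "x + y \<in> range vec" by (intro image_eqI[of _ _ "c + d"]) (simp_all add: vec_eq_iff)
next
  fix x :: "'a ^ 'k" and s assume "x \<in> range vec"
  then obtain c where "x = vec c" by auto
  then show "s *\<^sub>R x \<in> range vec" by (intro image_eqI[of _ _ "s *\<^sub>R c"]) (simp_all add: vec_eq_iff)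
qed

lemma orthogonal_range_vec_iff:
  fixes b :: "'a::euclidean_space ^ 'k::finite"
  shows "(\<forall>u\<in>range vec. u \<bullet> b = 0) \<longleftrightarrow> (\<Sum>k\<in>UNIV. b $ k) = 0"
proof -
  have "vec c \<bullet> b = c \<bullet> (\<Sum>k\<in>UNIV. b $ k)" for c
    by (simp add: inner_vec_def inner_sum_right)
  then show ?thesis by (metis (no_types, lifting) imageE inner_eq_zero_iff inner_zero_right rangeI)
qed

text \<open>The value 1 is the maximum of the inner product with \<open>b\<close> over the power of
  \<open>K\<close>, so \<open>x\<close> is a maximiser. Varying a single component of
  \<open>x\<close> gives the normality of that component of \<open>b\<close>.\<close>

lemma component_in_outer_normal_cone:
  fixes b x :: "'a::euclidean_space ^ 'k::finite"
  assumes "x \<in> cartesian_power K" "b \<in> relative_polar U (cartesian_power K)" "x \<bullet> b = 1"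
  shows "b $ k \<in> outer_normal_cone K (x $ k)"
  unfolding outer_normal_cone_def
proof (intro CollectI ballI)
  fix y assume "y \<in> K"
  define z where "z = (\<chi> l. if l = k then y else x $ l)"
  have "z \<in> cartesian_power K" using assms(1) \<open>y \<in> K\<close> by (simp add: cartesian_power_def z_def)
  then have "(z - x) \<bullet> b \<le> 0"
    using assms(2,3) by (simp add: relative_polar_def inner_diff_left)
  also have "(z - x) \<bullet> b = (\<Sum>l\<in>UNIV. if l = k then (y - x $ k) \<bullet> b $ k else 0)"
    unfolding inner_vec_def by (rule sum.cong) (auto simp: z_def)
  finally show "b $ k \<bullet> (y - x $ k) \<le> 0" by (simp add: inner_commute)
qed

text \<open>The injection \<open>r\<close> orders the index type. Caratheodory's theorem lets the number of vectors be
  fixed by the dimension, so that it can be a type and \<open>'a ^ 'k\<close> a Euclidean space.\<close>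

definition preceding_sum :: "('k::finite \<Rightarrow> nat) \<Rightarrow> 'a::real_vector ^ 'k \<Rightarrow> 'a ^ 'k" where
  "preceding_sum r a = (\<chi> k. \<Sum>l | r l < r k. a $ l)"

lemma linear_preceding_sum: "linear (preceding_sum r)"
  by (rule linearI) (simp_all add: preceding_sum_def vec_eq_iff sum.distrib scaleR_sum_right)

text \<open>The pairs with \<open>l\<close> before, after or equal to \<open>k\<close> exhaust all
  pairs, and the sum over all pairs is the product of the two total sums, which is 0. For
  \<open>a = b\<close> the action is thus half the squared norm.\<close>

lemma preceding_sum_inner:
  fixes a b :: "'a::euclidean_space ^ 'k::finite"
  assumes "inj r" "(\<Sum>k\<in>UNIV. a $ k) = 0"
  shows "preceding_sum r a \<bullet> b + a \<bullet> preceding_sum r b = - (a \<bullet> b)"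
proof -
  let ?f = "\<lambda>k l. a $ l \<bullet> b $ k"
  have 1: "preceding_sum r a \<bullet> b = (\<Sum>k\<in>UNIV. \<Sum>l\<in>UNIV. if r l < r k then ?f k l else 0)"
    by (simp add: inner_vec_def preceding_sum_def inner_sum_left sum.If_cases)
  have "a \<bullet> preceding_sum r b = (\<Sum>l\<in>UNIV. \<Sum>k\<in>UNIV. if r k < r l then ?f k l else 0)"
    by (simp add: inner_vec_def preceding_sum_def inner_sum_right sum.If_cases)
  also have "\<dots> = (\<Sum>k\<in>UNIV. \<Sum>l\<in>UNIV. if r k < r l then ?f k l else 0)"
    by (rule sum.swap)
  finally have 2: "a \<bullet> preceding_sum r b = \<dots>" .
  have 3: "a \<bullet> b = (\<Sum>k\<in>UNIV. \<Sum>l\<in>UNIV. if l = k then ?f k l else 0)"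
    by (simp add: inner_vec_def)
  have "preceding_sum r a \<bullet> b + a \<bullet> preceding_sum r b + a \<bullet> b
     = (\<Sum>k\<in>UNIV. \<Sum>l\<in>UNIV. ?f k l)"
    unfolding 1 2 3 sum.distrib[symmetric]
  proof (intro sum.cong refl)
    fix k l
    show "(if r l < r k then ?f k l else 0) + (if r k < r l then ?f k l else 0) +
          (if l = k then ?f k l else 0) = ?f k l"
      using injD[OF assms(1), of k l] by (auto simp: not_less)
  qed
  also have "\<dots> = 0"
    using assms(2) by (simp add: inner_sum_left[symmetric])
  finally show ?thesis by linarith
qed

text \<open>The test pair \<open>(a0, b0)\<close> bounds the maximal action \<open>M\<close> from
  below, and the maximiser yields a closed characteristic of action \<open>1 / M\<close>.\<close>

lemma c_EHZ_lagrangian_product_le: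
  fixes K T :: "'a::euclidean_space set" and a0 b0 :: "'a ^ 'k::finite" and r :: "'k \<Rightarrow> nat"
  assumes K: "compact K" "convex K" "interior K \<noteq> {}"
    and T: "compact T" "convex T" "interior T \<noteq> {}"
    and r: "bij_betw r UNIV {..<CARD('k)}"
    and a0: "a0 \<in> relative_polar (range vec) (cartesian_power T)"
    and b0: "b0 \<in> relative_polar (range vec) (cartesian_power K)"
    and pos: "0 < - (preceding_sum r a0 \<bullet> b0)"
  shows "c_EHZ (K \<times>\<^sub>L T) \<le> ereal (1 / - (preceding_sum r a0 \<bullet> b0))"
proof -
  let ?U = "range vec :: ('a ^ 'k) set" and ?m = "CARD('k)"
  define L where "L a = - preceding_sum r a" for a :: "'a ^ 'k"
  \<comment> \<open>\<open>L'\<close> is the adjoint of \<open>L\<close> against vectors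
    \<open>a\<close> of component sum zero. The sums in \<open>L\<close> stop before
    \<open>k\<close> and those in \<open>L'\<close> include \<open>k\<close>, because
    \<open>p\<close> moves before \<open>q\<close>.\<close>
  define L' where "L' b = b + preceding_sum r b" for b :: "'a ^ 'k"
  obtain x s where x: "0 < s" "cball x s \<subseteq> K"
    using K(3) by (auto simp: mem_interior_cball)
  obtain x' s' where x': "0 < s'" "cball x' s' \<subseteq> T"
    using T(3) by (auto simp: mem_interior_cball)
  have inj: "inj r" using r by (rule bij_betw_imp_inj_on)
  have sum0: "(\<Sum>k\<in>UNIV. a $ k) = 0" if "a \<in> relative_polar ?U A" for a A
    using that orthogonal_range_vec_iff by (auto simp: relative_polar_def)
  have adj: "L a \<bullet> b = a \<bullet> L' b" 
    if "a \<in> relative_polar ?U (cartesian_power T)" "b \<in> relative_polar ?U (cartesian_power K)" for a b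
    using preceding_sum_inner[OF inj sum0[OF that(1)], of b]
    by (simp add: L_def L'_def inner_add_right)
  have cont: "continuous_on UNIV L"
    unfolding L_def by (intro continuous_on_minus linear_continuous_on linear_conv_bounded_linear[THEN iffD1] linear_preceding_sum)
  have pos': "0 < L a0 \<bullet> b0" using pos by (simp add: L_def)
  obtain M a b v v' where M: "L a0 \<bullet> b0 \<le> M"
    and a: "a \<in> relative_polar ?U (cartesian_power T)" and b: "b \<in> relative_polar ?U (cartesian_power K)"
    and v: "v \<in> ?U" "v' \<in> ?U"
    and q: "(1 / M) *\<^sub>R L a - v \<in> cartesian_power K" and p: "(1 / M) *\<^sub>R L' b - v' \<in> cartesian_power T"
    and qb: "((1 / M) *\<^sub>R L a - v) \<bullet> b = 1" and pa: "((1 / M) *\<^sub>R L' b - v') \<bullet> a = 1"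
    by (rule bilinear_maximum_multipliers[where L=L and L'=L', OF subspace_range_vec
          compact_cartesian_power[OF K(1)] convex_cartesian_power[OF K(2)] rangeI
          cball_subset_cartesian_power[OF x(2)] x(1)
          compact_cartesian_power[OF T(1)] convex_cartesian_power[OF T(2)] rangeI
          cball_subset_cartesian_power[OF x'(2)] x'(1) cont _ a0 b0 pos'])
       (rule adj that; assumption)+
  have M0: "0 < M" using M pos by (simp add: L_def)
  obtain c c' where c: "v = vec c" "v' = vec c'" using v by auto
  define e where "e = inv_into UNIV r"
  have re: "r (e j) = j" if "j < ?m" for j
    using that r by (simp add: e_def bij_betw_inv_into_right)
  have e: "bij_betw e {..<?m} UNIV" unfolding e_def using r by (rule bij_betw_inv_into)
  have prec: "preceding_sum r d $ e j = (\<Sum>i<j. d $ e i)" if "j < ?m" for d :: "'a ^ 'k" and j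
  proof -
    have "{l. r l < j} = e ` {..<j}"
    proof (intro set_eqI iffI)
      fix l assume "l \<in> {l. r l < j}"
      then show "l \<in> e ` {..<j}" using inj by (intro image_eqI[of _ _ "r l"]) (simp_all add: e_def)
    qed (use re that in auto)
    moreover have "inj_on e {..<j}"
      using e that by (auto simp: bij_betw_def elim: inj_on_subset)
    ultimately show ?thesis using that by (simp add: preceding_sum_def re sum.reindex)
  qed
  have total: "(\<Sum>i<?m. d $ e i) = (\<Sum>k\<in>UNIV. d $ k)" for d :: "'a ^ 'k"
    by (rule sum.reindex_bij_betw[OF e])
  \<comment> \<open>Component \<open>e j\<close> of the first point is \<open>qs j\<close>, but that
    of the second is \<open>ps (Suc j)\<close>, by the inclusive sums in \<open>L'\<close>.\<close>
  define qs where "qs j = - (1 / M) *\<^sub>R (\<Sum>i<j. a $ e i) - c" for j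
  define ps where "ps j = (1 / M) *\<^sub>R (\<Sum>i<j. b $ e i) - c'" for j
  have qs: "qs j = ((1 / M) *\<^sub>R L a - v) $ e j" if "j < ?m" for j
    using prec[OF that] by (simp add: qs_def L_def c)
  have ps: "ps (Suc j) = ((1 / M) *\<^sub>R L' b - v') $ e j" if "j < ?m" for j
    using prec[OF that] by (simp add: ps_def L'_def c add.commute)
  have closed: "qs ?m = qs 0" "ps ?m = ps 0"
    using sum0[OF a] sum0[OF b] by (simp_all add: qs_def ps_def total)
  have scale: "(1 / M) *\<^sub>R z \<in> outer_normal_cone A y" if "z \<in> outer_normal_cone A y" for z y :: 'a and A
    using that M0 by (auto simp: outer_normal_cone_def divide_nonpos_pos)
  have dp: "ps (Suc j) - ps j = (1 / M) *\<^sub>R b $ e j" for j by (simp add: ps_def scaleR_add_right)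
  have dq: "qs j - qs (Suc j) = (1 / M) *\<^sub>R a $ e j" for j by (simp add: qs_def scaleR_add_right)
  have "(\<Sum>j<?m. qs j \<bullet> (ps (Suc j) - ps j)) = (\<Sum>j<?m. (1 / M) * (((1 / M) *\<^sub>R L a - v) $ e j \<bullet> b $ e j))"
    by (rule sum.cong) (simp_all add: dp qs del: vector_minus_component)
  also have "\<dots> = (1 / M) * (((1 / M) *\<^sub>R L a - v) \<bullet> b)"
    unfolding inner_vec_def sum_distrib_left by (rule sum.reindex_bij_betw[OF e])
  finally have action: "(\<Sum>j<?m. qs j \<bullet> (ps (Suc j) - ps j)) = 1 / M" using qb by simp
  have "c_EHZ (K \<times>\<^sub>L T) \<le> ereal (\<Sum>j<?m. qs j \<bullet> (ps (Suc j) - ps j))"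
  proof (rule c_EHZ_lagrangian_product_le_polygon[OF K(2) T(2) closed])
    \<comment> \<open>Membership is known for \<open>qs\<close> at indices 0 to
      \<open>?m - 1\<close> and for \<open>ps\<close> at 1 to \<open>?m\<close>; the missing ends
      follow from closedness.\<close>
    have Km: "qs j \<in> K" if "j < ?m" for j
      using q qs[OF that] by (simp add: cartesian_power_def)
    have Tm: "ps (Suc j) \<in> T" if "j < ?m" for j
      using p ps[OF that] by (simp add: cartesian_power_def)
    have m: "0 < ?m" by simp
    show "qs j \<in> K" if "j \<le> ?m" for j
      using Km[of j] Km[OF m] closed(1) that by (cases "j = ?m") simp_all
    show "ps j \<in> T" if "j \<le> ?m" for j
    proof (cases j)
      case 0
      then show ?thesis using Tm[of "?m - 1"] closed(2) by simp
    next
      case (Suc i)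
      then show ?thesis using Tm[of i] that by simp
    qed
    show "ps (Suc j) - ps j \<in> outer_normal_cone K (qs j)" if "j < ?m" for j
      unfolding dp qs[OF that] by (intro scale component_in_outer_normal_cone[OF q b qb])
    show "qs j - qs (Suc j) \<in> outer_normal_cone T (ps (Suc j))" if "j < ?m" for j
      unfolding dq ps[OF that] by (intro scale component_in_outer_normal_cone[OF p a pa])
    show "(\<Sum>j<?m. qs j \<bullet> (ps (Suc j) - ps j)) \<noteq> 0" using action M0 by simp
  qed
  moreover have "1 / M \<le> 1 / - (preceding_sum r a0 \<bullet> b0)"
    using M pos by (intro frac_le) (simp_all add: L_def)
  ultimately show ?thesis unfolding action using order_trans ereal_less_eq(3) by blast
qed

section \<open>Facet normals\<close>

text \<open>The test pair \<open>(a, a)\<close> has action \<open>(a \<bullet> a) / 2\<close> for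
  every ordering of the index type, so an arbitrary enumeration \<open>r\<close> is chosen.\<close>

corollary c_EHZ_lagrangian_square_le:
  fixes K :: "'a::euclidean_space set" and a :: "'a ^ 'k::finite"
  assumes K: "compact K" "convex K" "interior K \<noteq> {}"
    and a: "a \<in> relative_polar (range vec) (cartesian_power K)" "a \<noteq> 0"
  shows "c_EHZ (K \<times>\<^sub>L K) \<le> ereal (2 / (a \<bullet> a))"
proof -
  obtain r :: "'k \<Rightarrow> nat" where r: "bij_betw r UNIV {..<CARD('k)}"
    using ex_bij_betw_finite_nat[of "UNIV :: 'k set"] by (auto simp: atLeast0LessThan)
  have "(\<Sum>k\<in>UNIV. a $ k) = 0"
    using a(1) orthogonal_range_vec_iff by (auto simp: relative_polar_def)
  then have eq: "- (preceding_sum r a \<bullet> a) = (a \<bullet> a) / 2"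
    using preceding_sum_inner[of r a a] bij_betw_imp_inj_on[OF r] by (simp add: inner_commute)
  have "0 < - (preceding_sum r a \<bullet> a)" unfolding eq using a(2) by simp
  then show ?thesis using c_EHZ_lagrangian_product_le[OF K K r a(1) a(1)] by (simp add: eq)
qed

lemma inner_le_support_function:
  assumes "compact K" "x \<in> K"
  shows "x \<bullet> v \<le> support_function K v"
proof -
  have "compact ((\<lambda>x. x \<bullet> v) ` K)"
    using assms(1) by (intro compact_continuous_image continuous_intros)
  then show ?thesis
    unfolding support_function_def
    using assms(2) by (intro cSUP_upper) (auto intro: bounded_imp_bdd_above compact_imp_bounded)
qed

lemma c_EHZ_lagrangian_square_le_sum_heights:
  fixes K :: "'a::euclidean_space set" and j :: "'a \<Rightarrow> 'k::finite"
  assumes K: "compact K" "convex K" "interior K \<noteq> {}"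
    and S: "finite S" "\<And>v. v \<in> S \<Longrightarrow> norm v = 1" "inj_on j S"
    and u: "\<And>v. v \<in> S \<Longrightarrow> 0 \<le> u v" "sum u S = 1" "(\<Sum>v\<in>S. u v *\<^sub>R v) = 0"
  shows "c_EHZ (K \<times>\<^sub>L K) \<le> ereal (2 * (\<Sum>v\<in>S. (support_function K v)\<^sup>2))"
proof -
  let ?h = "support_function K"
  define s where "s = (\<Sum>v\<in>S. u v * ?h v)"
  \<comment> \<open>By injectivity of \<open>j\<close> the inner sum has at most one term: the
    vectors of \<open>S\<close> are placed at the indices \<open>j v\<close>, and all other
    components are 0.\<close>
  define a where "a = (\<chi> k. \<Sum>v | v \<in> S \<and> j v = k. (u v / s) *\<^sub>R v)"
  obtain x0 r where x0: "0 < r" "cball x0 r \<subseteq> K"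
    using K(3) by (auto simp: mem_interior_cball)
  \<comment> \<open>Positivity of \<open>s\<close>: each height is at least
    \<open>x0 \<bullet> v + r\<close>, and in the average with weights \<open>u\<close> the part
    with \<open>x0\<close> cancels. Single heights may be negative, since 0 need not lie in
    \<open>K\<close>.\<close>
  have "r = x0 \<bullet> (\<Sum>v\<in>S. u v *\<^sub>R v) + r * sum u S" by (simp add: u)
  also have "\<dots> = (\<Sum>v\<in>S. u v * ((x0 + r *\<^sub>R v) \<bullet> v))"
    unfolding inner_sum_right sum_distrib_left sum.distrib[symmetric]
    using S(2) by (intro sum.cong refl) (simp add: inner_add_left dot_square_norm algebra_simps)
  also have "\<dots> \<le> s"
    unfolding s_def
  proof (intro sum_mono mult_left_mono u)
    fix v assume "v \<in> S"
    then have "x0 + r *\<^sub>R v \<in> K"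
      using S(2) x0(1) by (intro subsetD[OF x0(2)]) (simp add: dist_norm)
    then show "(x0 + r *\<^sub>R v) \<bullet> v \<le> ?h v" using K(1) by (intro inner_le_support_function)
  qed
  finally have s: "0 < s" using x0(1) by simp
  have group: "(\<Sum>k\<in>UNIV. \<Sum>v | v \<in> S \<and> j v = k. f v) = sum f S" for f :: "'a \<Rightarrow> 'b::comm_monoid_add"
    using S(1) by (intro sum.group) auto
  have "(\<Sum>k\<in>UNIV. a $ k) = (\<Sum>v\<in>S. (u v / s) *\<^sub>R v)" by (simp add: a_def group)
  also have "\<dots> = (1 / s) *\<^sub>R (\<Sum>v\<in>S. u v *\<^sub>R v)" by (simp add: scaleR_sum_right)
  finally have "(\<Sum>k\<in>UNIV. a $ k) = 0" by (simp add: u)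
  moreover have "x \<bullet> a \<le> 1" if "x \<in> cartesian_power K" for x
  proof -
    have "x \<bullet> a = (\<Sum>k\<in>UNIV. \<Sum>v | v \<in> S \<and> j v = k. (u v / s) * (x $ j v \<bullet> v))"
      by (simp add: inner_vec_def a_def inner_sum_right)
    also have "\<dots> = (\<Sum>v\<in>S. (u v / s) * (x $ j v \<bullet> v))" by (rule group)
    also have "\<dots> \<le> (\<Sum>v\<in>S. (u v / s) * ?h v)"
      using that u(1) s K(1) by (intro sum_mono mult_left_mono inner_le_support_function)
        (auto simp: cartesian_power_def)
    also have "\<dots> = 1" using s by (simp add: s_def sum_divide_distrib[symmetric])
    finally show ?thesis .
  qed
  ultimately have polar: "a \<in> relative_polar (range vec) (cartesian_power K)"
    using orthogonal_range_vec_iff[of a] by (simp add: relative_polar_def)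
  have aj: "a $ j v = (u v / s) *\<^sub>R v" if "v \<in> S" for v
  proof -
    have "{w \<in> S. j w = j v} = {v}" using S(3) that by (auto dest: inj_onD)
    then show ?thesis by (simp add: a_def)
  qed
  have "a \<bullet> a = (\<Sum>k\<in>j ` S. a $ k \<bullet> a $ k)"
    unfolding inner_vec_def
  proof (rule sum.mono_neutral_right)
    show "\<forall>k\<in>UNIV - j ` S. a $ k \<bullet> a $ k = 0"
    proof
      fix k assume "k \<in> UNIV - j ` S"
      then have "{v \<in> S. j v = k} = {}" by auto
      then show "a $ k \<bullet> a $ k = 0" by (simp only: a_def vec_lambda_beta) simp
    qed
  qed auto
  also have "\<dots> = (\<Sum>v\<in>S. (u v)\<^sup>2 / s\<^sup>2)"
    using S(2) by (simp add: sum.reindex[OF S(3)] aj dot_square_norm power2_eq_square)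
  finally have aa: "a \<bullet> a = (\<Sum>v\<in>S. (u v)\<^sup>2) / s\<^sup>2" by (simp add: sum_divide_distrib)
  \<comment> \<open>Besides the final estimate, this shows that the weights have nonzero square sum,
    since \<open>s\<close> is positive.\<close>
  have CS: "s\<^sup>2 \<le> (\<Sum>v\<in>S. (u v)\<^sup>2) * (\<Sum>v\<in>S. (?h v)\<^sup>2)"
    unfolding s_def by (rule Cauchy_Schwarz_ineq_sum)
  have "0 \<le> (\<Sum>v\<in>S. (u v)\<^sup>2)" by (simp add: sum_nonneg)
  moreover have "(\<Sum>v\<in>S. (u v)\<^sup>2) \<noteq> 0" using CS s by auto
  ultimately have U: "0 < (\<Sum>v\<in>S. (u v)\<^sup>2)" by simp
  then have "a \<noteq> 0" using aa s by auto
  then have "c_EHZ (K \<times>\<^sub>L K) \<le> ereal (2 / (a \<bullet> a))"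
    by (rule c_EHZ_lagrangian_square_le[OF K polar])
  moreover have "2 / (a \<bullet> a) \<le> 2 * (\<Sum>v\<in>S. (?h v)\<^sup>2)"
    using CS U s by (simp add: aa field_simps)
  ultimately show ?thesis using order_trans ereal_less_eq(3) by blast
qed

text \<open>A direction making a negative inner product with every facet normal would give a ray that
  never leaves \<open>K\<close>.\<close>

lemma zero_in_convex_hull_facet_normals:
  fixes K :: "'a::euclidean_space set"
  assumes K: "polytope K" "interior K \<noteq> {}" and V: "finite V"
    and normal: "\<And>G. G facet_of K \<Longrightarrow> \<exists>v\<in>V. unit_outer_normal K G v"
  shows "0 \<in> convex hull V"
proof (rule ccontr)
  assume "0 \<notin> convex hull V"
  moreover have "closed (convex hull V)"
    using V by (simp add: compact_imp_closed finite_imp_compact_convex_hull)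
  ultimately obtain a b where ab: "0 < b" "\<forall>x\<in>convex hull V. b < a \<bullet> x"
    using separating_hyperplane_closed_point[of "convex hull V" 0] convex_convex_hull by auto
  then have neg: "a \<bullet> v > 0" if "v \<in> V" for v using that hull_inc[of v V convex] by fastforce
  \<comment> \<open>For empty \<open>V\<close> any nonzero direction will do; the contradiction then
    comes from the facet through which the ray leaves \<open>K\<close>.\<close>
  obtain l :: 'a where l: "l \<noteq> 0" "\<And>v. v \<in> V \<Longrightarrow> v \<bullet> l < 0"
  proof (cases "V = {}")
    case True
    then show ?thesis using that[of "SOME i. i \<in> Basis"] SOME_Basis nonzero_Basis by blast
  next
    case False
    then have "a \<noteq> 0" using neg by fastforce
    then show ?thesis using that[of "- a"] neg by (simp add: inner_commute)
  qed
  obtain x where x: "x \<in> interior K" using K(2) by blast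
  obtain d where d: "0 < d" "x + d *\<^sub>R l \<in> frontier K"
    using ray_to_frontier[OF polytope_imp_bounded[OF K(1)] x l(1)] by blast
  have "rel_frontier K = frontier K"
    using K(2) affine_hull_nonempty_interior[of K] rel_frontier_frontier by blast
  then have "frontier K = \<Union>{G. G facet_of K}"
    using rel_frontier_of_polyhedron[OF polytope_imp_polyhedron[OF K(1)]] by simp
  then obtain G where G: "G facet_of K" "x + d *\<^sub>R l \<in> G" using d(2) by blast
  obtain v where v: "v \<in> V" "unit_outer_normal K G v" using normal[OF G(1)] by blast
  then have "v \<bullet> (x - (x + d *\<^sub>R l)) \<le> 0"
    using G(2) x interior_subset by (fastforce simp: unit_outer_normal_def outer_normal_cone_def)
  then have "0 \<le> d * (v \<bullet> l)" by simp
  then show False using l(2)[OF v(1)] d(1) by (simp add: zero_le_mult_iff)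
qed

theorem theorem1p5:
  fixes K :: "((real ^ 'n) \<times> (real ^ 'n)) set"
    and F :: "nat \<Rightarrow> ((real ^ 'n) \<times> (real ^ 'n)) set"
    and \<nu> :: "nat \<Rightarrow> (real ^ 'n) \<times> (real ^ 'n)"
    and h :: "nat \<Rightarrow> real"
    and N :: nat
  assumes "polytope K" and "interior K \<noteq> {}"
    and "bij_betw F {1..N} {G. G facet_of K}"
    and "\<And>i. i \<in> {1..N} \<Longrightarrow> unit_outer_normal K (F i) (\<nu> i)"
    and "\<And>i. i \<in> {1..N} \<Longrightarrow> h i = support_function K (\<nu> i)"
  shows "c_EHZ (K \<times>\<^sub>L K) \<le> ereal (2 * (\<Sum>i = 1..N. (h i)\<^sup>2))"
proof -
  have "0 \<in> convex hull (\<nu> ` {1..N})"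
  proof (rule zero_in_convex_hull_facet_normals[OF assms(1,2)])
    fix G assume "G facet_of K"
    then have "G \<in> F ` {1..N}" using assms(3) by (simp add: bij_betw_def)
    then show "\<exists>v\<in>\<nu> ` {1..N}. unit_outer_normal K G v" using assms(4) by blast
  qed simp
  \<comment> \<open>Caratheodory's theorem leaves at most 2n + 1 normals, and 2n + 1 is exactly the
    cardinality of the index type \<open>('n + 'n) option\<close>.\<close>
  then obtain S where S: "finite S" "S \<subseteq> \<nu> ` {1..N}"
      "card S \<le> DIM((real ^ 'n) \<times> (real ^ 'n)) + 1" "0 \<in> convex hull S"
    unfolding caratheodory[of "\<nu> ` {1..N}"] by blast
  have "card S \<le> CARD(('n + 'n) option)"
    using S(3) by (simp add: card_UNIV_option card_UNIV_sum)
  then obtain j :: "_ \<Rightarrow> ('n + 'n) option" where j: "inj_on j S"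
    using card_le_inj[OF S(1), of "UNIV :: ('n + 'n) option set"] by auto
  obtain u where u: "\<forall>v\<in>S. 0 \<le> u v" "sum u S = 1" "(\<Sum>v\<in>S. u v *\<^sub>R v) = 0"
    using S(4) by (auto simp: convex_hull_finite[OF S(1)])
  have "norm v = 1" if "v \<in> S" for v
    using that S(2) assms(4) by (auto simp: unit_outer_normal_def)
  then have "c_EHZ (K \<times>\<^sub>L K) \<le> ereal (2 * (\<Sum>v\<in>S. (support_function K v)\<^sup>2))"
    using assms(1,2) S(1) j u
    by (intro c_EHZ_lagrangian_square_le_sum_heights[of K S j u])
       (auto simp: polytope_imp_compact polytope_imp_convex)
  \<comment> \<open>Both inequalities add nonnegative squares: those of the normals outside
    \<open>S\<close>, then those of indices sharing a normal.\<close>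
  moreover have "(\<Sum>v\<in>S. (support_function K v)\<^sup>2) \<le> (\<Sum>i = 1..N. (h i)\<^sup>2)"
  proof -
    have "(\<Sum>v\<in>S. (support_function K v)\<^sup>2) \<le> (\<Sum>v\<in>\<nu> ` {1..N}. (support_function K v)\<^sup>2)"
      using S(2) by (intro sum_mono2) auto
    also have "\<dots> \<le> (\<Sum>i = 1..N. (support_function K (\<nu> i))\<^sup>2)"
      using sum_image_le[of "{1..N}" "\<lambda>v. (support_function K v)\<^sup>2" \<nu>] by (simp add: o_def)
    finally show ?thesis using assms(5) by simp
  qed
  ultimately show ?thesis by (meson ereal_less_eq(3) mult_left_mono order_trans zero_le_numeral)
qed

end
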